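(* Let $u$ be a nonnegative integer and $n$ a positive integer. The symmetric function $$R_{n,u}:=\sum_{d\mid n} \bigl(c_d(n/d)\bigr)^u\,p_d^{\,n/d}$$ is a nonnegative integer combination of the symmetric functions $\{\ell_n^{(m)}\}_{m\mid n}$ in each of the following cases: (1) $u\in\{0,1\}$ and $n\ge 1$; (2) $u\ge 0$ and $n$ is square-free; (3) $u\ge 0$ and $n=4m$ where $m$ is odd and square-free.
   Context: $p_d$ is the $d$th power sum symmetric function. For positive integers $d,r$, the Ramanujan sum is $c_d(r)=\sum_{1\le k\le d,\ (k,d)=1}\exp(2\pi i k r/d)$ (an integer). For $u=0$ every coefficient $(c_d(n/d))^0$ is taken to be $1$ (so $0^0=1$) and $R_{n,0}=\sum_{d\mid n}p_d^{\,n/d}$. Let $C_n$ be the cyclic subgroup of the symmetric group $\mathfrak{S}_n$ generated by the long cycle $(1,2,\ldots,n)$; for $1\le r\le n$, $\ell_n^{(r)}$ denotes the Frobenius characteristic of the representation of $\mathfrak{S}_n$ induced from the one-dimensional character of $C_n$ sending the long cycle to $\exp(2\pi i r/n)$. *)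

theory Defs
  imports
    Complex_Main
    "HOL-Library.Multiset"
    "HOL-Combinatorics.Orbits"
    "HOL-Computational_Algebra.Squarefree"
    "HOL-Algebra.Left_Coset"
    "HOL-Algebra.Multiplicative_Group"
    "HOL-Algebra.Sym_Groups"
begin

section \<open>The ring of symmetric functions\<close>

text \<open>
  A finite multiset of indices stands for a monomial in the variables \<open>x\<^sub>0, x\<^sub>1, \<dots>\<close>, and a symmetric
  function is given by its coefficients: a formal power series of bounded degree that is invariant
  under all permutations of the variables.
\<close>

definition is_symfun :: "(nat multiset \<Rightarrow> 'a::zero) \<Rightarrow> bool" where
  "is_symfun f \<longleftrightarrow> (\<exists>D. \<forall>m. size m > D \<longrightarrow> f m = 0) \<and>
                  (\<forall>\<pi> m. bij \<pi> \<longrightarrow> f (image_mset \<pi> m) = f m)"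

typedef (overloaded) 'a symfun = "{f :: nat multiset \<Rightarrow> 'a::zero. is_symfun f}"
  morphisms sym_coeff Abs_symfun
  by (rule exI[of _ "\<lambda>_. 0"]) (simp add: is_symfun_def)

setup_lifting type_definition_symfun

definition splits :: "nat multiset \<Rightarrow> (nat multiset \<times> nat multiset) set" where
  "splits m = {(a, b). a + b = m}"

lemma finite_splits [simp]: "finite (splits m)"
proof -
  have "{a. a \<subseteq># m} \<subseteq> mset ` {xs. set xs \<subseteq> set_mset m \<and> length xs \<le> size m}"
  proof
    fix a assume "a \<in> {a. a \<subseteq># m}"
    moreover obtain xs where "a = mset xs" by (metis ex_mset)
    ultimately show "a \<in> mset ` {xs. set xs \<subseteq> set_mset m \<and> length xs \<le> size m}"
      by (auto simp: image_iff intro!: exI[of _ xs] dest: mset_subset_eqD size_mset_mono)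
  qed
  then have "finite {a. a \<subseteq># m}"
    by (rule finite_subset) (intro finite_imageI finite_lists_length_le finite_set_mset)
  moreover have "splits m \<subseteq> {a. a \<subseteq># m} \<times> {a. a \<subseteq># m}"
    by (auto simp: splits_def)
  ultimately show ?thesis
    by (meson finite_SigmaI finite_subset)
qed

lemma is_symfun_mult:
  fixes f g :: "nat multiset \<Rightarrow> 'a::comm_ring_1"
  assumes "is_symfun f" "is_symfun g"
  shows "is_symfun (\<lambda>m. \<Sum>(a, b)\<in>splits m. f a * g b)"
proof -
  obtain D E where D: "\<And>m. size m > D \<Longrightarrow> f m = 0" and E: "\<And>m. size m > E \<Longrightarrow> g m = 0"
    using assms by (auto simp: is_symfun_def)
  have "(\<Sum>(a, b)\<in>splits m. f a * g b) = 0" if "size m > D + E" for m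
  proof (rule sum.neutral, clarify)
    fix a b assume "(a, b) \<in> splits m"
    then have "size a + size b > D + E" using that by (auto simp: splits_def)
    then have "size a > D \<or> size b > E" by linarith
    then show "f a * g b = 0" using D E by auto
  qed
  moreover have "(\<Sum>(a, b)\<in>splits (image_mset \<pi> m). f a * g b) = (\<Sum>(a, b)\<in>splits m. f a * g b)"
    if "bij \<pi>" for \<pi> :: "nat \<Rightarrow> nat" and m
  proof (rule sum.reindex_bij_witness[where
        i = "\<lambda>(a, b). (image_mset \<pi> a, image_mset \<pi> b)" and
        j = "\<lambda>(a, b). (image_mset (inv' \<pi>) a, image_mset (inv' \<pi>) b)"])
    have [simp]: "\<pi> (inv' \<pi> x) = x" "inv' \<pi> (\<pi> x) = x" for x
      using that by (auto simp: bij_def surj_f_inv_f)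
    fix x
    { assume "x \<in> splits (image_mset \<pi> m)"
      then obtain a b where x: "x = (a, b)" "a + b = image_mset \<pi> m"
        by (auto simp: splits_def)
      have "image_mset (inv' \<pi>) (a + b) = m" by (simp only: x) (simp add: multiset.map_comp o_def)
      with x show "(case x of (a, b) \<Rightarrow> (image_mset (inv' \<pi>) a, image_mset (inv' \<pi>) b)) \<in> splits m"
        by (simp add: splits_def flip: image_mset_union)
      have "f (image_mset (inv' \<pi>) a) = f a" "g (image_mset (inv' \<pi>) b) = g b"
        using assms bij_imp_bij_inv[OF that] by (auto simp: is_symfun_def)
      with x show "(case (case x of (a, b) \<Rightarrow> (image_mset (inv' \<pi>) a, image_mset (inv' \<pi>) b)) of
          (a, b) \<Rightarrow> f a * g b) = (case x of (a, b) \<Rightarrow> f a * g b)" by simp }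
  qed (use that in \<open>auto simp: splits_def multiset.map_comp o_def bij_def surj_f_inv_f\<close>)
  ultimately show ?thesis
    unfolding is_symfun_def by blast
qed

instantiation symfun :: (comm_ring_1) comm_ring_1
begin

lift_definition zero_symfun :: "'a symfun" is "\<lambda>_. 0"
  by (simp add: is_symfun_def)

lift_definition one_symfun :: "'a symfun" is "\<lambda>m. if m = {#} then 1 else 0"
  by (auto simp: is_symfun_def)

lift_definition plus_symfun :: "'a symfun \<Rightarrow> 'a symfun \<Rightarrow> 'a symfun" is "\<lambda>f g m. f m + g m"
  unfolding is_symfun_def
proof safe
  fix f g :: "nat multiset \<Rightarrow> 'a" and D E
  assume "\<forall>m. D < size m \<longrightarrow> f m = 0" "\<forall>m. E < size m \<longrightarrow> g m = 0"
  then show "\<exists>D. \<forall>m. D < size m \<longrightarrow> f m + g m = 0"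
    by (intro exI[of _ "max D E"]) simp
qed auto

lift_definition uminus_symfun :: "'a symfun \<Rightarrow> 'a symfun" is "\<lambda>f m. - f m"
  by (simp add: is_symfun_def)

lift_definition minus_symfun :: "'a symfun \<Rightarrow> 'a symfun \<Rightarrow> 'a symfun" is "\<lambda>f g m. f m - g m"
  unfolding is_symfun_def
proof safe
  fix f g :: "nat multiset \<Rightarrow> 'a" and D E
  assume "\<forall>m. D < size m \<longrightarrow> f m = 0" "\<forall>m. E < size m \<longrightarrow> g m = 0"
  then show "\<exists>D. \<forall>m. D < size m \<longrightarrow> f m - g m = 0"
    by (intro exI[of _ "max D E"]) simp
qed auto

lift_definition times_symfun :: "'a symfun \<Rightarrow> 'a symfun \<Rightarrow> 'a symfun"
  is "\<lambda>f g m. \<Sum>(a, b)\<in>splits m. f a * g b"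
  by (rule is_symfun_mult)

instance
proof
  fix f g h :: "'a symfun"
  show "f + g + h = f + (g + h)" "f + g = g + f" "0 + f = f" "- f + f = 0" "f - g = f + - g"
    by (transfer; simp add: fun_eq_iff algebra_simps)+
  show "(0 :: 'a symfun) \<noteq> 1"
    by transfer (auto simp: fun_eq_iff)
  show "(f + g) * h = f * h + g * h"
    by transfer (simp add: fun_eq_iff case_prod_unfold algebra_simps sum.distrib)
  show "f * g = g * f"
  proof (transfer, rule ext)
    fix f g :: "nat multiset \<Rightarrow> 'a" and m
    show "(\<Sum>(a, b)\<in>splits m. f a * g b) = (\<Sum>(a, b)\<in>splits m. g a * f b)"
      by (rule sum.reindex_bij_witness[of _ prod.swap prod.swap])
         (auto simp: splits_def algebra_simps)
  qed
  show "1 * f = f"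
  proof (transfer, rule ext)
    fix f :: "nat multiset \<Rightarrow> 'a" and m
    have "(\<Sum>(a, b)\<in>splits m. (if a = {#} then 1 else 0) * f b)
        = (\<Sum>(a, b)\<in>{({#} :: nat multiset, m)}. (if a = {#} then 1 else 0) * f b)"
      by (intro sum.mono_neutral_right finite_splits) (auto simp: splits_def split: if_splits)
    then show "(\<Sum>(a, b)\<in>splits m. (if a = {#} then 1 else 0) * f b) = f m"
      by simp
  qed
  show "f * g * h = f * (g * h)"
  proof (transfer, rule ext)
    fix f g h :: "nat multiset \<Rightarrow> 'a" and m
    have "(\<Sum>(a, b)\<in>splits m. (\<Sum>(c, d)\<in>splits a. f c * g d) * h b)
        = (\<Sum>(x, y)\<in>(SIGMA x:splits m. splits (fst x)). f (fst y) * g (snd y) * h (snd x))"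
      by (simp add: sum.Sigma case_prod_unfold sum_distrib_right)
    also have "\<dots> = (\<Sum>(x, y)\<in>(SIGMA x:splits m. splits (snd x)). f (fst x) * (g (fst y) * h (snd y)))"
      by (rule sum.reindex_bij_witness[of _
            "\<lambda>((a, e), (d, b)). ((a + d, b), (a, d))" "\<lambda>((a, b), (c, d)). ((c, d + b), (d, b))"])
         (auto simp: splits_def algebra_simps)
    also have "\<dots> = (\<Sum>(a, b)\<in>splits m. f a * (\<Sum>(c, d)\<in>splits b. g c * h d))"
      by (simp add: sum.Sigma case_prod_unfold sum_distrib_left)
    finally show "(\<Sum>(a, b)\<in>splits m. (\<Sum>(c, d)\<in>splits a. f c * g d) * h b)
        = (\<Sum>(a, b)\<in>splits m. f a * (\<Sum>(c, d)\<in>splits b. g c * h d))" .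
  qed
qed

end

lift_definition sym_scale :: "'a::comm_ring_1 \<Rightarrow> 'a symfun \<Rightarrow> 'a symfun" (infixr "*\<^sub>s" 75)
  is "\<lambda>c f m. c * f m"
  unfolding is_symfun_def by (metis mult_zero_right)

text \<open>
  The power sum \<open>p\<^sub>d = x\<^sub>0\<^sup>d + x\<^sub>1\<^sup>d + \<dots>\<close> for \<open>d > 0\<close> (for \<open>d = 0\<close> the value is a junk value, never used).
\<close>

lift_definition power_sum :: "nat \<Rightarrow> 'a::comm_ring_1 symfun"
  is "\<lambda>d m. if \<exists>i. m = replicate_mset d i then 1 else 0"
proof -
  fix d
  have "(\<exists>i. image_mset \<pi> m = replicate_mset d i) \<longleftrightarrow> (\<exists>i. m = replicate_mset d i)"
    if "bij \<pi>" for \<pi> :: "nat \<Rightarrow> nat" and m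
  proof
    have inv: "image_mset (inv' \<pi>) (image_mset \<pi> m) = m"
      using that by (simp add: multiset.map_comp o_def bij_def)
    assume "\<exists>i. image_mset \<pi> m = replicate_mset d i"
    then obtain i where "image_mset \<pi> m = replicate_mset d i" ..
    with inv have "m = replicate_mset d (inv' \<pi> i)" by (metis image_replicate_mset)
    then show "\<exists>i. m = replicate_mset d i" ..
  qed auto
  then show "is_symfun (\<lambda>m. if \<exists>i. m = replicate_mset d i then 1 else 0 :: 'a)"
    unfolding is_symfun_def by (intro conjI exI[of _ d]) auto
qed


section \<open>Induced representations and the Frobenius characteristic\<close>

text \<open>
  The matrix of \<open>g\<close> in the representation of \<open>G\<close> induced from a linear character \<open>\<chi>\<close> of a subgroup
  \<open>H\<close>, with respect to the basis \<open>t\<^sub>A \<otimes> 1\<close> of \<open>\<complex>[G] \<otimes> \<complex>\<^sub>\<chi>\<close> (tensor product over \<open>\<complex>[H]\<close>), where \<open>A\<close> runs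
  through the left cosets of \<open>H\<close> and \<open>t\<^sub>A\<close> is a chosen representative of \<open>A\<close>.  The \<open>(A, B)\<close> entry is
  \<open>\<chi> (t\<^sub>A\<inverse> g t\<^sub>B)\<close>, where \<open>\<chi>\<close> is extended by \<open>0\<close> outside \<open>H\<close>.
\<close>

definition coset_rep :: "'g set \<Rightarrow> 'g" where
  "coset_rep A = (SOME a. a \<in> A)"

definition induced_rep ::
  "('g, 'b) monoid_scheme \<Rightarrow> 'g set \<Rightarrow> ('g \<Rightarrow> complex) \<Rightarrow> 'g \<Rightarrow> 'g set \<Rightarrow> 'g set \<Rightarrow> complex" where
  "induced_rep G H \<chi> g A B =
     (let h = inv\<^bsub>G\<^esub> (coset_rep A) \<otimes>\<^bsub>G\<^esub> g \<otimes>\<^bsub>G\<^esub> coset_rep B in if h \<in> H then \<chi> h else 0)"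

definition induced_character ::
  "('g, 'b) monoid_scheme \<Rightarrow> 'g set \<Rightarrow> ('g \<Rightarrow> complex) \<Rightarrow> 'g \<Rightarrow> complex" where
  "induced_character G H \<chi> g = (\<Sum>A\<in>lcosets\<^bsub>G\<^esub> H. induced_rep G H \<chi> g A A)"

text \<open>
  The power sum indexed by the cycle type of \<open>w\<close>; the cycles of \<open>w\<close>, fixed points included, are its
  orbits on \<open>{1..n}\<close>.
\<close>

definition power_sum_cycle_type :: "nat \<Rightarrow> (nat \<Rightarrow> nat) \<Rightarrow> complex symfun" where
  "power_sum_cycle_type n w = (\<Prod>S\<in>orbit w ` {1..n}. power_sum (card S))"

definition frobenius_characteristic :: "nat \<Rightarrow> ((nat \<Rightarrow> nat) \<Rightarrow> complex) \<Rightarrow> complex symfun" where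
  "frobenius_characteristic n \<chi> =
     (1 / fact n) *\<^sub>s (\<Sum>w\<in>carrier (sym_group n). \<chi> w *\<^sub>s power_sum_cycle_type n w)"


section \<open>The symmetric functions of the statement\<close>

definition long_cycle :: "nat \<Rightarrow> nat \<Rightarrow> nat" where
  "long_cycle n = cycle_of_list [1..<Suc n]"

definition cyclic_subgroup :: "nat \<Rightarrow> (nat \<Rightarrow> nat) set" where
  "cyclic_subgroup n = generate (sym_group n) {long_cycle n}"

text \<open>
  The linear character of the cyclic subgroup that maps the long cycle to \<open>exp (2\<pi>ir/n)\<close>; that the
  choice of the exponent is immaterial is lemma \<open>cyclic_character_power\<close> below.
\<close>

definition cyclic_character :: "nat \<Rightarrow> nat \<Rightarrow> (nat \<Rightarrow> nat) \<Rightarrow> complex" where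
  "cyclic_character n r w =
     exp (2 * of_real pi * \<i> * of_nat r / of_nat n) ^ (LEAST k. long_cycle n ^^ k = w)"

definition ell :: "nat \<Rightarrow> nat \<Rightarrow> complex symfun" where
  "ell n r = frobenius_characteristic n
     (induced_character (sym_group n) (cyclic_subgroup n) (cyclic_character n r))"

definition ramanujan_sum :: "nat \<Rightarrow> nat \<Rightarrow> complex" where
  "ramanujan_sum d r =
     (\<Sum>k | k \<in> {1..d} \<and> coprime k d. exp (2 * of_real pi * \<i> * of_nat k * of_nat r / of_nat d))"

definition ramanujan_symfun :: "nat \<Rightarrow> nat \<Rightarrow> complex symfun" where
  "ramanujan_symfun n u =
     (\<Sum>d | d dvd n. ramanujan_sum d (n div d) ^ u *\<^sub>s power_sum d ^ (n div d))"


section \<open>Adequacy of the definitions\<close>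

lemma long_cycle_apply:
  assumes "i < n"
  shows "long_cycle n (Suc i) = Suc (Suc i mod n)"
proof -
  let ?cs = "[1..<Suc n]"
  have "map (cycle_of_list ?cs) ?cs = rotate1 ?cs"
    by (rule cyclic_rotation[where n = 1, simplified]) simp
  then have "map (cycle_of_list ?cs) ?cs ! i = rotate1 ?cs ! i" by simp
  then show ?thesis using assms
    by (simp add: long_cycle_def nth_rotate1 del: upt_Suc)
qed

lemma long_cycle_funpow:
  assumes "n > 0"
  shows "(long_cycle n ^^ k) 1 = Suc (k mod n)"
proof (induction k)
  case (Suc k)
  then show ?case
    using long_cycle_apply[of "k mod n" n] assms by (simp add: mod_Suc_eq)
qed simp

lemma cyclic_character_power:
  assumes "n > 0"
  shows "cyclic_character n r (long_cycle n ^^ k) = exp (2 * of_real pi * \<i> * of_nat r / of_nat n) ^ k"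
proof -
  define j where "j = (LEAST j. long_cycle n ^^ j = long_cycle n ^^ k)"
  let ?z = "exp (2 * of_real pi * \<i> * of_nat r / of_nat n) :: complex"
  have "long_cycle n ^^ j = long_cycle n ^^ k"
    unfolding j_def by (rule LeastI) simp
  then have mod: "j mod n = k mod n"
    using long_cycle_funpow[OF assms, of j] long_cycle_funpow[OF assms, of k] by simp
  have "?z ^ n = exp (of_nat n * (2 * of_real pi * \<i> * of_nat r / of_nat n))"
    by (simp only: exp_of_nat_mult)
  also have "of_nat n * (2 * of_real pi * \<i> * of_nat r / of_nat n) = of_nat r * (2 * of_real pi * \<i>)"
    using assms by simp
  also have "exp (of_nat r * (2 * of_real pi * \<i>)) = 1"
    by (simp only: exp_of_nat_mult exp_two_pi_i power_one)
  finally have 1: "?z ^ n = 1" .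
  have "?z ^ i = ?z ^ (i mod n)" for i
  proof -
    have "?z ^ i = ?z ^ (n * (i div n) + i mod n)" by simp
    also have "\<dots> = ?z ^ (i mod n)" by (simp only: power_add power_mult 1) simp
    finally show ?thesis .
  qed
  then have "?z ^ j = ?z ^ k" using mod by metis
  then show ?thesis by (simp add: cyclic_character_def j_def)
qed

lemma long_cycle_in_sym_group: "long_cycle n \<in> carrier (sym_group n)"
  using cycle_permutes[of "[1..<Suc n]"]
  by (simp add: long_cycle_def sym_group_carrier atLeastLessThanSuc_atLeastAtMost del: upt_Suc)

lemma cyclic_subgroup_eq: "cyclic_subgroup n = range (\<lambda>k. long_cycle n ^^ k)"
proof -
  interpret group "sym_group n" by (rule sym_group_is_group)
  have fin: "finite (carrier (sym_group n))"
    by (simp add: sym_group_def finite_permutations)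
  have "long_cycle n [^]\<^bsub>sym_group n\<^esub> k = long_cycle n ^^ k" for k :: nat
    by (induction k)
       (simp_all add: sym_group_one sym_group_mult nat_pow_Suc funpow_Suc_right del: funpow.simps)
  then show ?thesis
    by (auto simp: cyclic_subgroup_def generate_pow_on_finite_carrier[OF fin long_cycle_in_sym_group])
qed

lemma cyclic_character_mult:
  assumes "n > 0" "v \<in> cyclic_subgroup n" "w \<in> cyclic_subgroup n"
  shows "cyclic_character n r (v \<circ> w) = cyclic_character n r v * cyclic_character n r w"
  using assms
  by (auto simp: cyclic_subgroup_eq cyclic_character_power power_add simp flip: funpow_add)

lemma induced_rep_mult:
  fixes G (structure)
  assumes "group G" "finite (carrier G)" "subgroup H G"
    and hom: "\<And>h k. h \<in> H \<Longrightarrow> k \<in> H \<Longrightarrow> \<chi> (h \<otimes> k) = \<chi> h * \<chi> k"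
    and x: "x \<in> carrier G" and y: "y \<in> carrier G"
    and A: "A \<in> lcosets H" and C: "C \<in> lcosets H"
  shows "induced_rep G H \<chi> (x \<otimes> y) A C = (\<Sum>B\<in>lcosets H. induced_rep G H \<chi> x A B * induced_rep G H \<chi> y B C)"
proof -
  interpret group G by fact
  interpret H: subgroup H G by fact
  have rep: "coset_rep B \<in> carrier G" "B = coset_rep B <# H" if B: "B \<in> lcosets H" for B
  proof -
    obtain a where a: "a \<in> carrier G" "B = a <# H" using B by (auto simp: LCOSETS_def)
    have "a \<in> B" using a lcos_self[OF a(1) assms(3)] by simp
    then have "coset_rep B \<in> B" unfolding coset_rep_def by (rule someI)
    with a show "coset_rep B \<in> carrier G" "B = coset_rep B <# H"
      using l_coset_subset_G[OF H.subset] l_repr_independence[OF _ _ assms(3)] by auto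
  qed
  define a where "a = coset_rep A"
  define c where "c = coset_rep C"
  have ac: "a \<in> carrier G" "c \<in> carrier G" using rep A C by (auto simp: a_def c_def)
  define D where "D = (y \<otimes> c) <# H"
  have D: "D \<in> lcosets H" using y ac by (auto simp: D_def LCOSETS_def)
  define d where "d = coset_rep D"
  have d: "d \<in> carrier G" "D = d <# H" using rep[OF D] by (auto simp: d_def)
  have iff: "inv (coset_rep B) \<otimes> y \<otimes> c \<in> H \<longleftrightarrow> B = D" if B: "B \<in> lcosets H" for B
  proof -
    have b: "coset_rep B \<in> carrier G" using rep B by blast
    have "inv (coset_rep B) \<otimes> y \<otimes> c \<in> H \<longleftrightarrow> y \<otimes> c \<in> coset_rep B <# H"
      using H.lcos_module_imp[OF assms(1) b] H.lcos_module_rev[OF assms(1) b] y ac b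
      by (metis m_assoc m_closed inv_closed)
    also have "\<dots> \<longleftrightarrow> B = D"
      using rep(2)[OF B] l_repr_independence[OF _ b assms(3)] lcos_self[OF _ assms(3)] y ac D_def
      by (metis m_closed)
    finally show ?thesis .
  qed
  have hD: "inv d \<otimes> y \<otimes> c \<in> H" using iff[OF D] by (simp add: d_def)
  have eq: "inv a \<otimes> (x \<otimes> y) \<otimes> c = (inv a \<otimes> x \<otimes> d) \<otimes> (inv d \<otimes> y \<otimes> c)"
    using ac d x y by (simp add: m_assoc) (metis inv_closed m_assoc m_closed r_inv l_one)
  have mem: "inv a \<otimes> (x \<otimes> y) \<otimes> c \<in> H \<longleftrightarrow> inv a \<otimes> x \<otimes> d \<in> H"
  proof
    assume "inv a \<otimes> (x \<otimes> y) \<otimes> c \<in> H"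
    then have "(inv a \<otimes> (x \<otimes> y) \<otimes> c) \<otimes> inv (inv d \<otimes> y \<otimes> c) \<in> H"
      using hD by blast
    moreover have "(inv a \<otimes> (x \<otimes> y) \<otimes> c) \<otimes> inv (inv d \<otimes> y \<otimes> c) = inv a \<otimes> x \<otimes> d"
      unfolding eq using ac d x y by (simp add: inv_solve_right')
    ultimately show "inv a \<otimes> x \<otimes> d \<in> H" by simp
  qed (use hD eq in auto)
  have "finite (lcosets H)"
    using assms(2) by (simp add: LCOSETS_def)
  then have "(\<Sum>B\<in>lcosets H. induced_rep G H \<chi> x A B * induced_rep G H \<chi> y B C)
      = (\<Sum>B\<in>{D}. induced_rep G H \<chi> x A B * induced_rep G H \<chi> y B C)"
    using D iff by (intro sum.mono_neutral_right) (auto simp: induced_rep_def c_def)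
  also have "\<dots> = induced_rep G H \<chi> (x \<otimes> y) A C"
    using hom[OF _ hD] hD mem eq
    by (simp add: induced_rep_def Let_def flip: a_def c_def d_def)
  finally show ?thesis by simp
qed

end

theory Submission
  imports Defs "HOL-Number_Theory.Cong" "HOL-Analysis.Complex_Transcendental"
begin

text \<open>
  Inducing the character of the cyclic group and regrouping its elements by order gives
  \<open>\<ell>\<^sub>n\<^sup>(\<^sup>r\<^sup>) = (1/n) \<Sum>\<^bsub>d | n\<^esub> c\<^sub>d(r) p\<^sub>d\<^bsup>n/d\<^esup>\<close> (lemma \<open>ell_conv_power_sums\<close>).  Hence weights \<open>a\<^sub>m\<close> express
  \<open>R\<^sub>n\<^sub>,\<^sub>u\<close> through the \<open>\<ell>\<^sub>n\<^sup>(\<^sup>m\<^sup>)\<close> as soon as \<open>\<Sum>\<^bsub>m | n\<^esub> a\<^sub>m c\<^sub>d(m) = n F(d)\<close> for all \<open>d | n\<close>, where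
  \<open>F(d) = c\<^sub>d(n/d)\<^sup>u\<close>.

  The Ramanujan sums are characterised by \<open>\<Sum>\<^bsub>d | t\<^esub> c\<^sub>d(m) = t\<close> if \<open>t | m\<close> and \<open>= 0\<close> otherwise.  Summing the
  linear system over the divisors \<open>d\<close> of \<open>t\<close>, which is an invertible operation, turns it into
  \<open>t A\<^sub>t = n \<Sum>\<^bsub>d | t\<^esub> F(d)\<close>, where \<open>A\<^sub>t\<close> is the sum of the \<open>a\<^sub>m\<close> with \<open>t | m | n\<close>.  This system is
  compatible with factoring \<open>n\<close> into coprime parts, because \<open>F\<close> is multiplicative, so products of solutions
  are solutions and only prime powers \<open>n = p\<^sup>k\<close> remain (lemma \<open>ell_positive_local\<close>).

  For \<open>n = p\<^sup>k\<close> the system is triangular.  With \<open>S\<^sub>b = F(1) + F(p) + \<dots> + F(p\<^sup>b)\<close> it says that the tail sums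
  of the weights are \<open>p\<^bsup>k-b\<^esup> S\<^sub>b\<close>, so the weights are nonnegative integers if the \<open>S\<^sub>b\<close> are natural
  numbers with \<open>S\<^bsub>b+1\<^esub> \<le> p S\<^sub>b\<close> (lemma \<open>ell_positive_prime_power\<close>).  This holds for \<open>u = 0\<close>, where
  \<open>S\<^sub>b = b + 1\<close>, and for \<open>u = 1\<close>, where \<open>S\<^sub>b = p\<^sup>b\<close> up to the middle \<open>b = k/2\<close> and \<open>S\<close> is constant afterwards,
  with value \<open>0\<close> or \<open>p\<^bsup>k/2\<^esup>\<close> according to the parity of \<open>k\<close>.  For \<open>n = p\<close> and \<open>n = 4\<close> all the values
  \<open>F(d)\<close> lie in \<open>{-1, 0, 1}\<close>, and every exponent \<open>u\<close> can be checked by hand; these prime powers are the only ones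
  that occur in the square-free case and in the case \<open>n = 4m\<close>.
\<close>


section \<open>Ramanujan sums\<close>

abbreviation units_upto :: "nat \<Rightarrow> nat set" where
  "units_upto d \<equiv> {k. k \<in> {1..d} \<and> coprime k d}"

text \<open>
  The fractions \<open>1/n, \<dots>, n/n\<close> in lowest terms have as denominators the divisors \<open>d\<close> of \<open>n\<close>, and each
  \<open>k/d\<close> with \<open>k\<close> prime to \<open>d\<close> occurs once, as \<open>(k (n/d))/n\<close>.
\<close>

lemma sum_regroup_lowest_terms:
  fixes f :: "nat \<Rightarrow> 'a::comm_monoid_add"
  assumes "n > 0"
  shows "(\<Sum>k=1..n. f k) = (\<Sum>d | d dvd n. \<Sum>k\<in>units_upto d. f (k * (n div d)))"
proof -
  have "(\<Sum>d | d dvd n. \<Sum>k\<in>units_upto d. f (k * (n div d)))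
      = (\<Sum>(d, k)\<in>(SIGMA d:{d. d dvd n}. units_upto d). f (k * (n div d)))"
    using assms by (subst sum.Sigma) auto
  also have "\<dots> = (\<Sum>k=1..n. f k)"
  proof (rule sum.reindex_bij_witness[of _ "\<lambda>k. (n div gcd k n, k div gcd k n)" "\<lambda>(d, k). k * (n div d)"])
    fix k assume k: "k \<in> {1..n}"
    then have g: "gcd k n > 0" by simp
    have "coprime (k div gcd k n) (n div gcd k n)"
      using g by (simp add: div_gcd_coprime)
    moreover have "n div (n div gcd k n) = gcd k n"
      using assms by (metis div_div_eq_right div_self dvd_refl gcd_dvd2 mult_1 less_numeral_extra(3))
    ultimately show "(case (n div gcd k n, k div gcd k n) of (d, k) \<Rightarrow> k * (n div d)) = k"
      "(n div gcd k n, k div gcd k n) \<in> (SIGMA d:{d. d dvd n}. units_upto d)"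
      using k by (auto intro: div_le_mono simp: Suc_le_eq div_greater_zero_iff dvd_imp_le div_dvd_iff_mult)
  next
    fix x assume x: "x \<in> (SIGMA d:{d. d dvd n}. units_upto d)"
    obtain d k where dk: "x = (d, k)" "d dvd n" "1 \<le> k" "k \<le> d" "coprime k d" using x by auto
    define e where "e = n div d"
    have n: "n = d * e" "e > 0" "d > 0" using dk assms by (auto simp: e_def)
    have "gcd (k * e) (d * e) = e" using gcd_mult_distrib_nat[of e k d] dk(5) by (simp add: mult.commute)
    then show "(n div gcd (case x of (d, k) \<Rightarrow> k * (n div d)) n,
          (case x of (d, k) \<Rightarrow> k * (n div d)) div gcd (case x of (d, k) \<Rightarrow> k * (n div d)) n) = x"
      "(case x of (d, k) \<Rightarrow> k * (n div d)) \<in> {1..n}"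
      using n dk by auto
  qed auto
  finally show ?thesis ..
qed

lemma sum_roots_of_unity:
  assumes "t > 0"
  shows "(\<Sum>k=1..t. exp (2 * of_real pi * \<i> * of_nat k * of_nat m / of_nat t) :: complex)
       = (if t dvd m then of_nat t else 0)"
proof -
  define z :: complex where "z = exp (2 * of_real pi * \<i> * of_nat m / of_nat t)"
  have pow: "exp (2 * of_real pi * \<i> * of_nat k * of_nat m / of_nat t) = z ^ k" for k
    unfolding z_def by (simp add: exp_of_nat_mult [symmetric] mult_ac)
  have one: "z = 1 \<longleftrightarrow> t dvd m"
    unfolding z_def using assms by (intro complex_root_unity_eq_1) simp
  have zt: "z ^ t = 1" 
    using complex_root_unity_eq_1[of t "t*m"] assms unfolding pow[symmetric] by (simp add: mult_ac)
  have "(\<Sum>k=1..t. z ^ k) = (if t dvd m then of_nat t else 0)"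
  proof (cases "t dvd m")
    case True
    then show ?thesis using one by simp
  next
    case False
    have "(\<Sum>k=1..t. z ^ k) = (\<Sum>k<t. z ^ Suc k)"
      by (rule sum.reindex_bij_witness[of _ Suc "\<lambda>k. k - 1"]) auto
    also have "\<dots> = z * (\<Sum>k<t. z ^ k)" by (simp add: sum_distrib_left)
    also have "(\<Sum>k<t. z ^ k) = 0"
      using False one zt by (simp add: geometric_sum)
    finally show ?thesis using False by simp
  qed
  then show ?thesis by (simp add: pow)
qed

text \<open>
  The primitive \<open>d\<close>-th roots of unity, for all \<open>d | t\<close>, make up all \<open>t\<close>-th roots of unity, whose \<open>m\<close>-th powers
  sum to \<open>t\<close> or \<open>0\<close>.  Together with the next lemma this characterises the Ramanujan sums, and it yields their
  multiplicativity and their values at prime powers.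
\<close>

lemma sum_ramanujan_sum_divisors:
  assumes "t > 0"
  shows "(\<Sum>d | d dvd t. ramanujan_sum d m) = (if t dvd m then of_nat t else 0)"
proof -
  have "(\<Sum>d | d dvd t. ramanujan_sum d m)
      = (\<Sum>d | d dvd t. \<Sum>k\<in>units_upto d. exp (2 * of_real pi * \<i> * of_nat (k * (t div d)) * of_nat m / of_nat t))"
    unfolding ramanujan_sum_def
  proof (intro sum.cong refl)
    fix d k assume "d \<in> {d. d dvd t}"
    then obtain e where e: "t = d * e" by auto
    with assms have "d > 0" "e > 0" by auto
    then show "exp (2 * complex_of_real pi * \<i> * of_nat k * of_nat m / of_nat d) =
           exp (2 * complex_of_real pi * \<i> * of_nat (k * (t div d)) * of_nat m / of_nat t)"
      by (simp add: e field_simps)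
  qed
  also have "\<dots> = (if t dvd m then of_nat t else 0)"
    using sum_roots_of_unity[OF assms, of m] unfolding sum_regroup_lowest_terms[OF assms] .
  finally show ?thesis .
qed

text \<open>
  This is the uniqueness half of Moebius inversion: the value at \<open>t\<close> is the divisor sum at \<open>t\<close> minus values at
  proper divisors.
\<close>

lemma divisor_sums_determine:
  fixes f g :: "nat \<Rightarrow> 'a::ab_group_add"
  assumes "n > 0" and eq: "\<And>t. t dvd n \<Longrightarrow> (\<Sum>d | d dvd t. f d) = (\<Sum>d | d dvd t. g d)"
    and "t dvd n"
  shows "f t = g t"
  using \<open>t dvd n\<close>
proof (induction t rule: less_induct)
  case (less t)
  have t: "t > 0" using less.prems assms(1) by (auto intro: dvd_pos_nat)
  have split: "{d. d dvd t} = insert t {d. d dvd t \<and> d < t}"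
    using t by (auto dest: dvd_imp_le simp: le_less)
  have *: "(\<Sum>d | d dvd t. h d) = h t + (\<Sum>d | d dvd t \<and> d < t. h d)" for h :: "nat \<Rightarrow> 'a"
    unfolding split by (subst sum.insert) auto
  have "(\<Sum>d | d dvd t \<and> d < t. f d) = (\<Sum>d | d dvd t \<and> d < t. g d)"
    using less by (intro sum.cong refl) (auto intro: dvd_trans)
  then show ?case using eq[OF less.prems] by (simp add: *)
qed

lemma gcd_mult_coprime_divisors:
  fixes a b d e :: nat
  assumes "coprime a b" "d dvd a" "e dvd b"
  shows "gcd (d * e) a = d" "gcd (d * e) b = e"
proof -
  have "coprime e a" "coprime d b"
    using assms by (meson coprime_commute coprime_divisors dvd_refl)+
  then show "gcd (d * e) a = d" "gcd (d * e) b = e"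
    using assms by (simp_all add: gcd_mult_right_right_cancel gcd_mult_left_right_cancel gcd_mult_left_left_cancel gcd_mult_right_left_cancel coprime_commute gcd_nat.absorb1)
qed

lemma divisors_mult_coprime:
  fixes a b d :: nat
  assumes "coprime a b"
  shows "d dvd a * b \<longleftrightarrow> d = gcd d a * gcd d b"
proof
  assume "d dvd a * b"
  then show "d = gcd d a * gcd d b"
    by (metis assms division_decomp gcd_mult_coprime_divisors)
next
  assume "d = gcd d a * gcd d b"
  then show "d dvd a * b" by (metis mult_dvd_mono gcd_dvd2)
qed

lemma sum_divisors_mult_coprime:
  fixes f :: "nat \<Rightarrow> 'a::comm_monoid_add"
  assumes "coprime a b" "a > 0" "b > 0"
  shows "(\<Sum>d | d dvd a * b. f d) = (\<Sum>d | d dvd a. \<Sum>e | e dvd b. f (d * e))"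
proof -
  have "(\<Sum>d | d dvd a. \<Sum>e | e dvd b. f (d * e)) = (\<Sum>(d, e)\<in>{d. d dvd a} \<times> {e. e dvd b}. f (d * e))"
    by (rule sum.cartesian_product)
  also have "\<dots> = (\<Sum>d | d dvd a * b. f d)"
    using divisors_mult_coprime[OF assms(1)] gcd_mult_coprime_divisors[OF assms(1)]
    by (intro sum.reindex_bij_witness[of _ "\<lambda>d. (gcd d a, gcd d b)" "\<lambda>(d, e). d * e"]) (auto intro: mult_dvd_mono)
  finally show ?thesis ..
qed

text \<open>
  Both sides, as functions of the divisor \<open>d e\<close> of \<open>a b\<close>, have the same divisor sums: at \<open>t = s r\<close> with
  \<open>s | a\<close> and \<open>r | b\<close> these are \<open>t\<close> if \<open>s | k\<close> and \<open>r | l\<close>, that is if \<open>t | k l\<close>, and \<open>0\<close> otherwise.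
\<close>

lemma ramanujan_sum_mult_coprime:
  assumes "coprime a b" "a > 0" "b > 0" "d dvd a" "e dvd b" "k dvd a" "l dvd b"
  shows "ramanujan_sum (d * e) (k * l) = ramanujan_sum d k * ramanujan_sum e l"
proof -
  let ?g = "\<lambda>t. ramanujan_sum (gcd t a) k * ramanujan_sum (gcd t b) l"
  have "ramanujan_sum (d * e) (k * l) = ?g (d * e)"
  proof (rule divisor_sums_determine[of "a * b" "\<lambda>t. ramanujan_sum t (k * l)" ?g])
    fix t assume t: "t dvd a * b"
    define s where "s = gcd t a"
    define r where "r = gcd t b"
    have sr: "t = s * r" "s dvd a" "r dvd b" "s > 0" "r > 0"
      using divisors_mult_coprime[OF assms(1)] t assms(2,3) by (auto simp: s_def r_def)
    have cop: "coprime s r" "coprime k b" "coprime l a"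
      using assms sr by (meson coprime_commute coprime_divisors dvd_refl)+
    have iff: "s * r dvd k * l \<longleftrightarrow> s dvd k \<and> r dvd l"
    proof
      assume *: "s * r dvd k * l"
      have "coprime s l" "coprime r k" using cop sr by (meson coprime_commute coprime_divisors dvd_refl)+
      then show "s dvd k \<and> r dvd l" using * 
        by (metis coprime_dvd_mult_left_iff coprime_dvd_mult_right_iff dvd_mult_left dvd_mult_right)
    qed (auto intro: mult_dvd_mono)
    have "(\<Sum>d | d dvd t. ?g d) = (\<Sum>d | d dvd s. \<Sum>e | e dvd r. ?g (d * e))"
      unfolding sr(1) by (rule sum_divisors_mult_coprime) (use cop sr in auto)
    also have "\<dots> = (\<Sum>d | d dvd s. \<Sum>e | e dvd r. ramanujan_sum d k * ramanujan_sum e l)"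
      using sr by (intro sum.cong refl) (simp, metis gcd_mult_coprime_divisors[OF assms(1)] dvd_trans)
    also have "\<dots> = (\<Sum>d | d dvd s. ramanujan_sum d k) * (\<Sum>e | e dvd r. ramanujan_sum e l)"
      by (simp add: sum_product)
    also have "\<dots> = (\<Sum>d | d dvd t. ramanujan_sum d (k * l))"
      using sr by (simp add: sum_ramanujan_sum_divisors iff)
    finally show "(\<Sum>d | d dvd t. ramanujan_sum d (k * l)) = (\<Sum>d | d dvd t. ?g d)" ..
  qed (use assms in \<open>auto intro: mult_dvd_mono\<close>)
  then show ?thesis
    using gcd_mult_coprime_divisors[OF assms(1,4,5)] by simp
qed

lemma divisors_prime_power:
  fixes p :: nat assumes "prime p"
  shows "{d. d dvd p ^ k} = (\<lambda>i. p ^ i) ` {..k}"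
  using divides_primepow_nat[OF assms] by auto

lemma sum_divisors_prime_power:
  fixes p :: nat and f :: "nat \<Rightarrow> 'a::comm_monoid_add"
  assumes "prime p"
  shows "(\<Sum>d | d dvd p ^ k. f d) = (\<Sum>i\<le>k. f (p ^ i))"
  unfolding divisors_prime_power[OF assms]
  using assms by (subst sum.reindex) (auto simp: inj_on_def prime_power_inj o_def)

lemma ramanujan_sum_1_left: "ramanujan_sum (Suc 0) m = 1"
  using sum_ramanujan_sum_divisors[of 1 m] by simp

text \<open>
  The divisors of \<open>p\<^sup>i\<^sup>+\<^sup>1\<close> are \<open>p\<^sup>i\<^sup>+\<^sup>1\<close> and those of \<open>p\<^sup>i\<close>, so the value is a difference of consecutive divisor
  sums.
\<close>

lemma ramanujan_sum_prime_power_Suc: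
  assumes "prime p"
  shows "ramanujan_sum (p ^ Suc i) m =
    (if p ^ Suc i dvd m then of_nat (p ^ Suc i) else 0) - (if p ^ i dvd m then of_nat (p ^ i) else 0)"
proof -
  have "(\<Sum>j\<le>k. ramanujan_sum (p ^ j) m) = (if p ^ k dvd m then of_nat (p ^ k) else 0)" for k
    using sum_ramanujan_sum_divisors[of "p ^ k" m] assms
    by (simp only: sum_divisors_prime_power[OF assms]) (simp add: prime_gt_0_nat)
  from this[of "Suc i"] this[of i] show ?thesis by (simp only: sum.atMost_Suc) (simp add: algebra_simps)
qed


section \<open>Expansion of \<open>\<ell>\<^sub>n\<^sup>(\<^sup>r\<^sup>)\<close> in power sums\<close>

lemma sym_scale_add_left: "(b + c) *\<^sub>s f = b *\<^sub>s f + c *\<^sub>s f"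
  by transfer (simp add: algebra_simps)

lemma sym_scale_add_right: "c *\<^sub>s (f + g) = c *\<^sub>s f + c *\<^sub>s g"
  by transfer (simp add: algebra_simps)

lemma sym_scale_scale: "b *\<^sub>s c *\<^sub>s f = (b * c) *\<^sub>s f"
  by transfer (simp add: algebra_simps)

lemma sym_scale_zero: "0 *\<^sub>s f = 0" "c *\<^sub>s 0 = 0"
  by (transfer; simp)+

lemma sym_scale_one: "1 *\<^sub>s f = f"
  by transfer simp

lemma sym_scale_sum_left: "(\<Sum>i\<in>I. c i) *\<^sub>s f = (\<Sum>i\<in>I. c i *\<^sub>s f)"
  by (induction I rule: infinite_finite_induct) (simp_all add: sym_scale_zero sym_scale_add_left)

lemma sym_scale_sum_right: "c *\<^sub>s (\<Sum>i\<in>I. f i) = (\<Sum>i\<in>I. c *\<^sub>s f i)"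
  by (induction I rule: infinite_finite_induct) (simp_all add: sym_scale_zero sym_scale_add_right)

lemma of_nat_mult_symfun: "of_nat k * f = of_nat k *\<^sub>s f"
  by (induction k) (simp_all add: sym_scale_zero sym_scale_add_left sym_scale_one algebra_simps)

lemma orbit_conjugate:
  assumes "bij t"
  shows "orbit (t \<circ> w \<circ> inv' t) (t x) = t ` orbit w x"
proof -
  have "((t \<circ> w \<circ> inv' t) ^^ k) (t x) = t ((w ^^ k) x)" for k
    by (induction k) (use assms in \<open>simp_all add: bij_is_inj inv_f_f\<close>)
  then show ?thesis by (auto simp: orbit_altdef)
qed

text \<open>
  Conjugation by \<open>t\<close> moves every cycle by \<open>t\<close>, which keeps its length.
\<close>

lemma power_sum_cycle_type_conjugate:
  assumes "t permutes {1..n}"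
  shows "power_sum_cycle_type n (t \<circ> w \<circ> inv' t) = power_sum_cycle_type n w"
proof -
  have t: "bij t" using assms by (rule permutes_bij)
  have "orbit (t \<circ> w \<circ> inv' t) ` {1..n} = orbit (t \<circ> w \<circ> inv' t) ` t ` {1..n}"
    using permutes_image[OF assms] by simp
  also have "\<dots> = (`) t ` orbit w ` {1..n}"
    by (simp add: image_image orbit_conjugate[OF t])
  finally have "power_sum_cycle_type n (t \<circ> w \<circ> inv' t) = (\<Prod>S\<in>(`) t ` orbit w ` {1..n}. power_sum (card S))"
    by (simp only: power_sum_cycle_type_def)
  also have "\<dots> = (\<Prod>S\<in>orbit w ` {1..n}. power_sum (card (t ` S)))"
    using t by (subst prod.reindex) (simp_all add: inj_on_def inj_image_eq_iff[OF bij_is_inj])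
  also have "\<dots> = power_sum_cycle_type n w"
    using t by (simp add: power_sum_cycle_type_def card_image bij_is_inj inj_on_subset[OF _ subset_UNIV])
  finally show ?thesis .
qed

lemma lcoset_rep_in_carrier:
  fixes G (structure)
  assumes "group G" "subgroup H G" "A \<in> lcosets H"
  shows "coset_rep A \<in> carrier G"
proof -
  interpret group G by fact
  obtain a where a: "a \<in> carrier G" "A = a <# H" using assms(3) by (auto simp: LCOSETS_def)
  then have "a \<in> A" using lcos_self[OF _ assms(2)] by simp
  then have "coset_rep A \<in> A" unfolding coset_rep_def by (rule someI)
  then show ?thesis using a l_coset_subset_G[OF subgroup.subset[OF assms(2)]] by auto
qed

text \<open>
  In the double sum over group elements \<open>w\<close> and cosets \<open>A\<close>, conjugation by the representative of \<open>A\<close> carries the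
  terms of \<open>A\<close> to the sum over \<open>H\<close>, because the cycle type is invariant.  All cosets thus contribute equally, and
  their number is \<open>n! / card H\<close>.
\<close>

lemma frobenius_characteristic_induced_character:
  assumes H: "subgroup H (sym_group n)"
  shows "frobenius_characteristic n (induced_character (sym_group n) H \<psi>)
       = (1 / of_nat (card H)) *\<^sub>s (\<Sum>h\<in>H. \<psi> h *\<^sub>s power_sum_cycle_type n h)"
proof -
  interpret group "sym_group n" by (rule sym_group_is_group)
  let ?G = "carrier (sym_group n)"
  let ?L = "lcosets\<^bsub>sym_group n\<^esub> H"
  let ?p = "power_sum_cycle_type n"
  have fin: "finite ?G" by (simp add: sym_group_def finite_permutations)
  have HG: "H \<subseteq> ?G" using H by (rule subgroup.subset)
  have coset: "(\<Sum>w\<in>?G. induced_rep (sym_group n) H \<psi> w A A *\<^sub>s ?p w) = (\<Sum>h\<in>H. \<psi> h *\<^sub>s ?p h)"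
    if A: "A \<in> ?L" for A
  proof -
    define t where "t = coset_rep A"
    have t: "t \<in> ?G" unfolding t_def by (rule lcoset_rep_in_carrier[OF sym_group_is_group H A])
    then have tp: "t permutes {1..n}" by (simp add: sym_group_carrier)
    then have tb: "bij t" by (rule permutes_bij)
    have closed: "w \<circ> v \<in> ?G" if "w \<in> ?G" "v \<in> ?G" for w v
      using m_closed[OF that] by (simp add: sym_group_mult)
    have "(\<Sum>w\<in>?G. induced_rep (sym_group n) H \<psi> w A A *\<^sub>s ?p w)
        = (\<Sum>h\<in>?G. (if h \<in> H then \<psi> h else 0) *\<^sub>s ?p h)"
    proof (rule sum.reindex_bij_witness[of _ "\<lambda>h. t \<circ> h \<circ> inv' t" "\<lambda>w. inv' t \<circ> w \<circ> t"])
      fix w assume w: "w \<in> ?G"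
      show "t \<circ> (inv' t \<circ> w \<circ> t) \<circ> inv' t = w" "inv' t \<circ> (t \<circ> w \<circ> inv' t) \<circ> t = w"
        using tb by (auto simp: fun_eq_iff bij_is_inj bij_is_surj surj_f_inv_f)
      show "inv' t \<circ> w \<circ> t \<in> ?G" "t \<circ> w \<circ> inv' t \<in> ?G"
        using w t by (auto intro!: closed sym_group_inv_closed)
      have "?p w = ?p (inv' t \<circ> w \<circ> t)"
        using power_sum_cycle_type_conjugate[OF permutes_inv[OF tp], of w] tb by (simp add: inv_inv_eq)
      then show "(if inv' t \<circ> w \<circ> t \<in> H then \<psi> (inv' t \<circ> w \<circ> t) else 0) *\<^sub>s ?p (inv' t \<circ> w \<circ> t)
          = induced_rep (sym_group n) H \<psi> w A A *\<^sub>s ?p w"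
        using t by (simp add: induced_rep_def sym_group_mult flip: t_def)
    qed
    also have "\<dots> = (\<Sum>h\<in>H. \<psi> h *\<^sub>s ?p h)"
      using HG fin by (intro sum.mono_neutral_cong_right) (auto simp: sym_scale_zero)
    finally show ?thesis .
  qed
  have "(\<Sum>w\<in>?G. induced_character (sym_group n) H \<psi> w *\<^sub>s ?p w)
      = (\<Sum>A\<in>?L. \<Sum>w\<in>?G. induced_rep (sym_group n) H \<psi> w A A *\<^sub>s ?p w)"
    unfolding induced_character_def sym_scale_sum_left by (rule sum.swap)
  also have "\<dots> = of_nat (card ?L) *\<^sub>s (\<Sum>h\<in>H. \<psi> h *\<^sub>s ?p h)"
    by (simp add: coset of_nat_mult_symfun)
  finally have eq: "frobenius_characteristic n (induced_character (sym_group n) H \<psi>)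
      = (of_nat (card ?L) / fact n) *\<^sub>s (\<Sum>h\<in>H. \<psi> h *\<^sub>s ?p h)"
    by (simp add: frobenius_characteristic_def sym_scale_scale)
  have "card ?G = fact n"
    using card_permutations[of "{1..n}" n] by (simp add: sym_group_def)
  then have "card ?L * card H = fact n"
    using l_lagrange[OF fin H] by (simp add: order_def)
  then have "of_nat (card ?L) * of_nat (card H) = (fact n :: complex)"
    by (metis of_nat_fact of_nat_mult)
  then have "of_nat (card ?L) / fact n = 1 / (of_nat (card H) :: complex)"
    by (metis divide_self_if fact_nonzero mult_eq_0_iff nonzero_divide_mult_cancel_left)
  then show ?thesis by (simp add: eq)
qed

lemma long_cycle_funpow_Suc:
  assumes "i < n"
  shows "(long_cycle n ^^ k) (Suc i) = Suc ((i + k) mod n)"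
proof (induction k)
  case (Suc k)
  then show ?case
    using long_cycle_apply[of "(i + k) mod n" n] assms by (simp add: mod_Suc_eq)
qed (use assms in simp)

text \<open>
  On residues modulo \<open>n = d e\<close> the permutation is the translation by \<open>k e\<close>, whose order is \<open>d\<close> because \<open>k\<close> is
  prime to \<open>d\<close>.
\<close>

lemma card_orbit_long_cycle_power:
  assumes i: "i \<in> {1..n}" and d: "d dvd n" and k: "coprime k d"
  shows "card (orbit (long_cycle n ^^ (k * (n div d))) i) = d"
proof -
  define e where "e = n div d"
  define f where "f = long_cycle n ^^ (k * e)"
  have n: "n = d * e" "n > 0" using assms by (auto simp: e_def)
  then have de: "d > 0" "e > 0" by auto
  obtain j where j: "i = Suc j" "j < n" using i by (cases i) auto
  have pow: "(f ^^ m) i = Suc ((j + m * (k * e)) mod n)" for m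
    unfolding f_def j(1) funpow_mult long_cycle_funpow_Suc[OF j(2)] by (simp add: mult.commute)
  have eq: "(f ^^ m) i = (f ^^ l) i \<longleftrightarrow> m mod d = l mod d" for m l
  proof -
    have "(f ^^ m) i = (f ^^ l) i \<longleftrightarrow> [j + m * (k * e) = j + l * (k * e)] (mod n)"
      by (simp add: pow cong_def)
    also have "\<dots> \<longleftrightarrow> [(m * k) * e = (l * k) * e] (mod (d * e))"
      by (simp add: cong_add_lcancel_nat n(1) mult.assoc)
    also have "\<dots> \<longleftrightarrow> m mod d = l mod d"
      using de cong_mult_rcancel_nat[OF k, of m l] by (simp add: cong_def mod_mult_mult2)
    finally show ?thesis .
  qed
  have "orbit f i = {(f ^^ m) i | m. m < d}"
    using eq[of d 0] de by (intro orbit_altdef_bounded) simp_all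
  also have "\<dots> = (\<lambda>m. (f ^^ m) i) ` {..<d}" by auto
  finally have "orbit f i = (\<lambda>m. (f ^^ m) i) ` {..<d}" .
  moreover have "inj_on (\<lambda>m. (f ^^ m) i) {..<d}" by (auto simp: inj_on_def eq)
  ultimately show ?thesis by (simp add: card_image f_def e_def)
qed

text \<open>
  All cycles have length \<open>d\<close> and they partition \<open>n\<close> points, so there are \<open>n/d\<close> of them.
\<close>

lemma power_sum_cycle_type_long_cycle_power:
  assumes n: "n > 0" and d: "d dvd n" and k: "coprime k d"
  shows "power_sum_cycle_type n (long_cycle n ^^ (k * (n div d))) = power_sum d ^ (n div d)"
proof -
  define f where "f = long_cycle n ^^ (k * (n div d))"
  have f: "f permutes {1..n}"
    using long_cycle_in_sym_group[of n] by (simp add: f_def sym_group_carrier permutes_funpow)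
  then have perm: "permutation f" using permutation_permutes by blast
  have card: "card S = d" if "S \<in> orbit f ` {1..n}" for S
    using that card_orbit_long_cycle_power[OF _ d k] by (auto simp: f_def)
  have union: "\<Union> (orbit f ` {1..n}) = {1..n}"
    using permutes_orbit_subset[OF f] permutation_self_in_orbit[OF perm] by blast
  have disj: "S \<inter> T = {}" if "S \<in> orbit f ` {1..n}" "T \<in> orbit f ` {1..n}" "S \<noteq> T" for S T
  proof (rule ccontr)
    assume "S \<inter> T \<noteq> {}"
    then obtain x i j where x: "x \<in> orbit f i" "x \<in> orbit f j" and ST: "S = orbit f i" "T = orbit f j"
      using \<open>S \<in> _\<close> \<open>T \<in> _\<close> by blast
    then have "i \<in> orbit f x" "j \<in> orbit f x"
      by (auto intro: orbit_swap permutation_self_in_orbit[OF perm])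
    then have "S = T" using x unfolding ST by (blast intro: orbit_trans)
    then show False using \<open>S \<noteq> T\<close> by simp
  qed
  have "d * card (orbit f ` {1..n}) = card (\<Union> (orbit f ` {1..n}))"
    by (rule card_partition) (use card disj union in auto)
  then have "card (orbit f ` {1..n}) = n div d"
    unfolding union using d n by auto
  then show ?thesis
    using card by (simp add: power_sum_cycle_type_def flip: f_def)
qed

text \<open>
  The subgroup consists of the \<open>n\<close> powers of the long cycle.  The exponents are grouped as the numerators of the
  fractions with denominator \<open>n\<close>: those with reduced denominator \<open>d\<close> share the cycle type \<open>p\<^sub>d\<^bsup>n/d\<^esup>\<close>, and the
  character values on them add up to a Ramanujan sum.
\<close>

lemma ell_conv_power_sums:
  assumes n: "n > 0"
  shows "ell n r = (1 / of_nat n) *\<^sub>s (\<Sum>d | d dvd n. ramanujan_sum d r *\<^sub>s power_sum d ^ (n div d))"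
proof -
  let ?c = "long_cycle n"
  let ?p = "power_sum_cycle_type n"
  let ?z = "\<lambda>k. exp (2 * of_real pi * \<i> * of_nat r / of_nat n) ^ k :: complex"
  have sub: "subgroup (cyclic_subgroup n) (sym_group n)"
    unfolding cyclic_subgroup_def
    using group.generate_is_subgroup[OF sym_group_is_group] long_cycle_in_sym_group by simp
  have inj: "inj_on (\<lambda>k. ?c ^^ k) {1..n}"
  proof (rule inj_onI)
    fix k l assume "k \<in> {1..n}" "l \<in> {1..n}" "?c ^^ k = ?c ^^ l"
    moreover from this have "k mod n = l mod n"
      using long_cycle_funpow[OF n] by (metis Suc_inject)
    ultimately show "k = l"
      using n by (auto simp: le_less)
  qed
  have "?c ^^ k \<in> (\<lambda>k. ?c ^^ k) ` {1..n}" for k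
  proof -
    have period: "?c ^^ n = id"
    proof
      fix x show "(?c ^^ n) x = id x"
      proof (cases "x \<in> {1..n}")
        case True
        then obtain j where "x = Suc j" "j < n" by (cases x) auto
        then show ?thesis by (simp add: long_cycle_funpow_Suc)
      next
        case False
        moreover have "(?c ^^ n) permutes {1..n}"
          using long_cycle_in_sym_group[of n] by (simp add: sym_group_carrier permutes_funpow)
        ultimately show ?thesis by (simp add: permutes_def)
      qed
    qed
    have red: "?c ^^ k = ?c ^^ (k mod n)"
    proof -
      have "?c ^^ k = ?c ^^ (n * (k div n) + k mod n)" by simp
      also have "\<dots> = ?c ^^ (k mod n)"
        by (simp only: funpow_add funpow_mult[symmetric] period) simp
      finally show ?thesis .
    qed
    \<comment> \<open>The exponents run through \<open>{1..n}\<close>, so the residue \<open>0\<close> is represented by \<open>n\<close>.\<close>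
    show ?thesis
    proof (cases "k mod n = 0")
      case True
      then have "?c ^^ k = ?c ^^ n" using red period by simp
      then show ?thesis using n by auto
    next
      case False
      then show ?thesis using red n by (auto intro!: imageI simp: less_imp_le)
    qed
  qed
  then have H: "cyclic_subgroup n = (\<lambda>k. ?c ^^ k) ` {1..n}"
    by (auto simp: cyclic_subgroup_eq)
  have "ell n r = (1 / of_nat n) *\<^sub>s (\<Sum>h\<in>cyclic_subgroup n. cyclic_character n r h *\<^sub>s ?p h)"
    unfolding ell_def frobenius_characteristic_induced_character[OF sub]
    using inj by (simp add: H card_image)
  also have "(\<Sum>h\<in>cyclic_subgroup n. cyclic_character n r h *\<^sub>s ?p h) = (\<Sum>k=1..n. ?z k *\<^sub>s ?p (?c ^^ k))"
    unfolding H using inj by (simp add: sum.reindex cyclic_character_power[OF n])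
  also have "\<dots> = (\<Sum>d | d dvd n. \<Sum>k\<in>units_upto d. ?z (k * (n div d)) *\<^sub>s ?p (?c ^^ (k * (n div d))))"
    by (rule sum_regroup_lowest_terms[OF n])
  also have "\<dots> = (\<Sum>d | d dvd n. ramanujan_sum d r *\<^sub>s power_sum d ^ (n div d))"
  proof (rule sum.cong[OF refl])
    fix d assume "d \<in> {d. d dvd n}"
    then have d: "d dvd n" by simp
    then obtain e where e: "n = d * e" by auto
    with n have de: "d > 0" "e > 0" by auto
    have "?z (k * (n div d)) *\<^sub>s ?p (?c ^^ (k * (n div d)))
        = exp (2 * of_real pi * \<i> * of_nat k * of_nat r / of_nat d) *\<^sub>s power_sum d ^ (n div d)"
      if "k \<in> units_upto d" for k
    proof -
      have "?z (k * (n div d)) = exp (of_nat (k * (n div d)) * (2 * of_real pi * \<i> * of_nat r / of_nat n))"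
        by (rule exp_of_nat_mult[symmetric])
      also have "of_nat (k * (n div d)) * (2 * of_real pi * \<i> * of_nat r / of_nat n)
          = 2 * of_real pi * \<i> * of_nat k * of_nat r / (of_nat d :: complex)"
        using de by (simp add: e field_simps)
      finally show ?thesis
        using power_sum_cycle_type_long_cycle_power[OF n d, of k] that by simp
    qed
    then show "(\<Sum>k\<in>units_upto d. ?z (k * (n div d)) *\<^sub>s ?p (?c ^^ (k * (n div d))))
        = ramanujan_sum d r *\<^sub>s power_sum d ^ (n div d)"
      by (simp add: ramanujan_sum_def sym_scale_sum_left)
  qed
  finally show ?thesis .
qed

text \<open>
  It suffices to compare the coefficients of \<open>p\<^sub>d\<^bsup>n/d\<^esup>\<close>.
\<close>

lemma ramanujan_symfun_conv_ell:
  assumes n: "n > 0"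
    and a: "\<And>d. d dvd n \<Longrightarrow>
      (\<Sum>m | m dvd n. of_nat (a m) * ramanujan_sum d m) = of_nat n * ramanujan_sum d (n div d) ^ u"
  shows "ramanujan_symfun n u = (\<Sum>m | m dvd n. of_nat (a m) * ell n m)"
proof -
  have "(\<Sum>m | m dvd n. of_nat (a m) * ell n m)
      = (\<Sum>d | d dvd n. ((1 / of_nat n) * (\<Sum>m | m dvd n. of_nat (a m) * ramanujan_sum d m)) *\<^sub>s power_sum d ^ (n div d))"
    by (simp add: ell_conv_power_sums[OF n] of_nat_mult_symfun sym_scale_sum_right sym_scale_scale
        sym_scale_sum_left sum_distrib_left mult_ac)
       (rule sum.swap)
  also have "\<dots> = ramanujan_symfun n u"
    using n by (simp add: ramanujan_symfun_def a)
  finally show ?thesis ..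
qed


section \<open>Nonnegative integral weights\<close>

text \<open>
  The linear system for the weights, summed over divisors.  The equations range over the divisors \<open>t\<close>
  instead of over the single coefficients because in this form the left-hand side contains no Ramanujan sums, which
  makes the system multiplicative in \<open>n\<close> and triangular for prime powers.
\<close>

definition ell_positive :: "nat \<Rightarrow> nat \<Rightarrow> bool" where
  "ell_positive n u \<longleftrightarrow> (\<exists>a :: nat \<Rightarrow> nat. \<forall>t. t dvd n \<longrightarrow>
     of_nat (t * (\<Sum>m | m dvd n \<and> t dvd m. a m)) = of_nat n * (\<Sum>d | d dvd t. ramanujan_sum d (n div d) ^ u))"

text \<open>
  The divisor sums over \<open>d | t\<close> of the two sides agree by assumption, hence so do the two sides.
\<close>

lemma ell_positive_imp_weights:
  assumes "n > 0" "ell_positive n u"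
  shows "\<exists>a :: nat \<Rightarrow> nat. \<forall>d. d dvd n \<longrightarrow>
     (\<Sum>m | m dvd n. of_nat (a m) * ramanujan_sum d m) = of_nat n * ramanujan_sum d (n div d) ^ u"
proof -
  obtain a :: "nat \<Rightarrow> nat" where a: "\<And>t. t dvd n \<Longrightarrow>
     of_nat (t * (\<Sum>m | m dvd n \<and> t dvd m. a m)) = of_nat n * (\<Sum>d | d dvd t. ramanujan_sum d (n div d) ^ u)"
    using assms(2) by (auto simp: ell_positive_def)
  have "(\<Sum>m | m dvd n. of_nat (a m) * ramanujan_sum d m) = of_nat n * ramanujan_sum d (n div d) ^ u"
    if "d dvd n" for d
  proof (rule divisor_sums_determine[OF assms(1) _ that, of
        "\<lambda>d. \<Sum>m | m dvd n. of_nat (a m) * ramanujan_sum d m" "\<lambda>d. of_nat n * ramanujan_sum d (n div d) ^ u"])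
    fix t assume t: "t dvd n"
    then have t0: "t > 0" using assms(1) by (auto intro: dvd_pos_nat)
    have "(\<Sum>d | d dvd t. \<Sum>m | m dvd n. of_nat (a m) * ramanujan_sum d m)
        = (\<Sum>m | m dvd n. of_nat (a m) * (\<Sum>d | d dvd t. ramanujan_sum d m))"
      by (subst sum.swap) (simp add: sum_distrib_left)
    also have "\<dots> = (\<Sum>m | m dvd n. if t dvd m then of_nat (t * a m) else 0)"
      by (intro sum.cong refl) (simp add: sum_ramanujan_sum_divisors[OF t0] mult.commute)
    also have "\<dots> = of_nat (t * (\<Sum>m | m dvd n \<and> t dvd m. a m))"
      using assms(1) sum.inter_filter[of "{m. m dvd n}" "\<lambda>m. of_nat (t * a m) :: complex" "\<lambda>m. t dvd m"]
      by (simp add: sum_distrib_left)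
    also have "\<dots> = of_nat n * (\<Sum>d | d dvd t. ramanujan_sum d (n div d) ^ u)"
      by (rule a[OF t])
    finally show "(\<Sum>d | d dvd t. \<Sum>m | m dvd n. of_nat (a m) * ramanujan_sum d m)
        = (\<Sum>d | d dvd t. of_nat n * ramanujan_sum d (n div d) ^ u)"
      by (simp add: sum_distrib_left)
  qed
  then show ?thesis by blast
qed

text \<open>
  If \<open>a\<close> and \<open>b\<close> solve the systems for \<open>n\<close> and \<open>k\<close>, then \<open>m \<mapsto> a(m\<^sub>1) b(m\<^sub>2)\<close> solves the one for \<open>n k\<close>, where
  \<open>m = m\<^sub>1 m\<^sub>2\<close> with \<open>m\<^sub>1 | n\<close> and \<open>m\<^sub>2 | k\<close>: both sides of the system factor.
\<close>

lemma ell_positive_mult_coprime: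
  assumes cop: "coprime n k" and pos: "n > 0" "k > 0" and "ell_positive n u" "ell_positive k u"
  shows "ell_positive (n * k) u"
proof -
  obtain a :: "nat \<Rightarrow> nat" where a: "\<And>t. t dvd n \<Longrightarrow>
     of_nat (t * (\<Sum>m | m dvd n \<and> t dvd m. a m)) = of_nat n * (\<Sum>d | d dvd t. ramanujan_sum d (n div d) ^ u)"
    using assms(4) by (auto simp: ell_positive_def)
  obtain b :: "nat \<Rightarrow> nat" where b: "\<And>t. t dvd k \<Longrightarrow>
     of_nat (t * (\<Sum>m | m dvd k \<and> t dvd m. b m)) = of_nat k * (\<Sum>d | d dvd t. ramanujan_sum d (k div d) ^ u)"
    using assms(5) by (auto simp: ell_positive_def)
  define c where "c m = a (gcd m n) * b (gcd m k)" for m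
  show ?thesis unfolding ell_positive_def
  proof (intro exI[of _ c] allI impI)
    fix t assume t: "t dvd n * k"
    define s where "s = gcd t n"
    define r where "r = gcd t k"
    have sr: "t = s * r" "s dvd n" "r dvd k" "s > 0" "r > 0"
      using divisors_mult_coprime[OF cop] t pos by (auto simp: s_def r_def)
    have iff: "t dvd x * y \<longleftrightarrow> s dvd x \<and> r dvd y" if "x dvd n" "y dvd k" for x y
    proof
      assume *: "t dvd x * y"
      have "coprime s y" "coprime r x"
        using cop sr that by (meson coprime_commute coprime_divisors)+
      then show "s dvd x \<and> r dvd y" using * unfolding sr(1)
        by (metis coprime_dvd_mult_left_iff coprime_dvd_mult_right_iff dvd_mult_left dvd_mult_right)
    qed (auto simp: sr(1) intro: mult_dvd_mono)
    have "(\<Sum>m | m dvd n * k \<and> t dvd m. c m) = (\<Sum>m | m dvd n * k. if t dvd m then c m else 0)"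
      using pos sum.inter_filter[of "{m. m dvd n * k}" c "\<lambda>m. t dvd m"] by simp
    also have "\<dots> = (\<Sum>x | x dvd n. \<Sum>y | y dvd k. if t dvd x * y then c (x * y) else 0)"
      by (rule sum_divisors_mult_coprime[OF cop pos])
    also have "\<dots> = (\<Sum>x | x dvd n. \<Sum>y | y dvd k. (if s dvd x then a x else 0) * (if r dvd y then b y else 0))"
      using gcd_mult_coprime_divisors[OF cop] by (intro sum.cong refl) (auto simp: iff c_def)
    also have "\<dots> = (\<Sum>x | x dvd n. if s dvd x then a x else 0) * (\<Sum>y | y dvd k. if r dvd y then b y else 0)"
      by (simp only: sum_product)
    also have "\<dots> = (\<Sum>x | x dvd n \<and> s dvd x. a x) * (\<Sum>y | y dvd k \<and> r dvd y. b y)"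
      using pos sum.inter_filter[of "{m. m dvd n}" a "\<lambda>m. s dvd m"]
        sum.inter_filter[of "{m. m dvd k}" b "\<lambda>m. r dvd m"] by simp
    finally have "(of_nat (t * (\<Sum>m | m dvd n * k \<and> t dvd m. c m)) :: complex)
        = of_nat (s * (\<Sum>x | x dvd n \<and> s dvd x. a x)) * of_nat (r * (\<Sum>y | y dvd k \<and> r dvd y. b y))"
      by (simp add: sr(1))
    also have "\<dots> = of_nat (n * k) * (\<Sum>d | d dvd s. \<Sum>e | e dvd r. (ramanujan_sum d (n div d) * ramanujan_sum e (k div e)) ^ u)"
      unfolding a[OF sr(2)] b[OF sr(3)] by (simp add: sum_product power_mult_distrib)
    also have "(\<Sum>d | d dvd s. \<Sum>e | e dvd r. (ramanujan_sum d (n div d) * ramanujan_sum e (k div e)) ^ u)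
        = (\<Sum>d | d dvd s. \<Sum>e | e dvd r. ramanujan_sum (d * e) (n * k div (d * e)) ^ u)"
    proof (intro sum.cong refl)
      fix d e assume "d \<in> {d. d dvd s}" "e \<in> {e. e dvd r}"
      then have "d dvd n" "e dvd k" using sr by (auto intro: dvd_trans)
      moreover from this have "n div d dvd n" "k div e dvd k"
        by (metis dvd_div_mult_self dvd_triv_left)+
      ultimately show "(ramanujan_sum d (n div d) * ramanujan_sum e (k div e)) ^ u = ramanujan_sum (d * e) (n * k div (d * e)) ^ u"
        using ramanujan_sum_mult_coprime[OF cop pos, of d e "n div d" "k div e"] by (simp add: div_mult_div_if_dvd)
    qed
    also have "\<dots> = (\<Sum>d | d dvd t. ramanujan_sum d (n * k div d) ^ u)"
      unfolding sr(1) by (rule sum_divisors_mult_coprime[symmetric]) (use sr cop in \<open>auto intro: coprime_divisors\<close>)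
    finally show "of_nat (t * (\<Sum>m | m dvd n * k \<and> t dvd m. c m))
        = of_nat (n * k) * (\<Sum>d | d dvd t. ramanujan_sum d (n * k div d) ^ u)" .
  qed
qed

lemma ell_positive_local:
  assumes "n > 0" "\<And>p. prime p \<Longrightarrow> p dvd n \<Longrightarrow> ell_positive (p ^ multiplicity p n) u"
  shows "ell_positive n u"
  using assms
proof (induction n rule: less_induct)
  case (less n)
  show ?case
  proof (cases "n = 1")
    case True
    then show ?thesis
      by (auto simp: ell_positive_def ramanujan_sum_1_left intro!: exI[of _ "\<lambda>_. 1"])
  next
    case False
    then obtain p where p: "prime p" "p dvd n" using prime_factor_nat by blast
    define e where "e = multiplicity p n"
    obtain k where k: "n = p ^ e * k" "\<not> p dvd k"
      unfolding e_def using multiplicity_decompose'[of n p] p(1) less.prems(1) not_prime_unit by (metis neq0_conv)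
    have e: "e > 0" using p less.prems(1) by (simp add: e_def prime_multiplicity_gt_zero_iff)
    have cop: "coprime (p ^ e) k" using p k(2) by (simp add: prime_imp_coprime)
    have pos: "k > 0" "p ^ e > 0" using k(1) less.prems(1) by auto
    have "1 < p ^ e" using e prime_gt_1_nat[OF p(1)] by (intro one_less_power)
    then have "k < n" using k(1) pos(1) by simp
    moreover have "ell_positive (q ^ multiplicity q k) u" if q: "prime q" "q dvd k" for q
    proof -
      have "q \<noteq> p" using k(2) q by auto
      then have "multiplicity q (p ^ e) = 0"
        using p q by (simp add: multiplicity_distinct_prime_power)
      then have "multiplicity q n = multiplicity q k"
        using k(1) pos q(1) by (simp add: prime_elem_multiplicity_mult_distrib)
      moreover have "q dvd n" using q k(1) by simp
      ultimately show ?thesis using less.prems(2)[OF q(1)] by simp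
    qed
    ultimately have "ell_positive k u" using less.IH pos(1) by blast
    moreover have "ell_positive (p ^ e) u" using less.prems(2)[OF p] by (simp add: e_def)
    ultimately show ?thesis
      unfolding k(1) by (intro ell_positive_mult_coprime[OF cop pos(2,1)])
  qed
qed

text \<open>
  The equation at \<open>t = p\<^sup>j\<close> prescribes the sum of the weights of \<open>p\<^sup>j, \<dots>, p\<^sup>k\<close> to be \<open>p\<^bsup>k-j\<^esup> S\<^sub>j\<close>.  The single
  weights are differences of consecutive tail sums, and the growth condition makes them nonnegative.
\<close>

lemma ell_positive_prime_power:
  fixes p k :: nat and S :: "nat \<Rightarrow> nat"
  assumes p: "prime p"
    and S: "\<And>b. b \<le> k \<Longrightarrow> (\<Sum>i\<le>b. ramanujan_sum (p ^ i) (p ^ (k - i)) ^ u) = of_nat (S b)"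
    and growth: "\<And>b. b < k \<Longrightarrow> S (Suc b) \<le> p * S b"
  shows "ell_positive (p ^ k) u"
proof -
  define \<alpha> where "\<alpha> b = p ^ (k - b) * S b - (if b < k then p ^ (k - Suc b) * S (Suc b) else 0)" for b
  have tail: "(\<Sum>b=j..k. \<alpha> b) = p ^ (k - j) * S j" if "j \<le> k" for j
    using that
  proof (induction j rule: inc_induct)
    case (step j)
    have "p ^ (k - j) = p ^ (k - Suc j) * p"
      using step(2) by (metis Suc_diff_Suc power_Suc2)
    then have "p ^ (k - Suc j) * S (Suc j) \<le> p ^ (k - j) * S j"
      using growth[OF step(2)] by simp
    then show ?case using step by (simp add: sum.atLeast_Suc_atMost \<alpha>_def)
  qed (simp add: \<alpha>_def)
  show ?thesis unfolding ell_positive_def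
  proof (intro exI[of _ "\<lambda>m. \<alpha> (multiplicity p m)"] allI impI)
    fix t assume "t dvd p ^ k"
    then obtain j where j: "t = p ^ j" "j \<le> k" using divides_primepow_nat[OF p] by blast
    have p2: "p \<ge> 2" using p by (rule prime_ge_2_nat)
    have "(\<Sum>m | m dvd p ^ k \<and> t dvd m. \<alpha> (multiplicity p m))
        = (\<Sum>m | m dvd p ^ k. if t dvd m then \<alpha> (multiplicity p m) else 0)"
      using p sum.inter_filter[of "{m. m dvd p ^ k}" "\<lambda>m. \<alpha> (multiplicity p m)" "\<lambda>m. t dvd m"]
      by (simp add: prime_gt_0_nat)
    also have "\<dots> = (\<Sum>b\<le>k. if j \<le> b then \<alpha> b else 0)"
      unfolding sum_divisors_prime_power[OF p] using p p2
      by (simp add: j(1) dvd_power_iff_le multiplicity_prime_power[OF prime_imp_prime_elem] cong: if_cong)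
    also have "\<dots> = (\<Sum>b=j..k. \<alpha> b)"
      using sum.inter_filter[of "{..k}" \<alpha> "\<lambda>b. j \<le> b", symmetric]
      by (simp, intro sum.cong) auto
    finally have "t * (\<Sum>m | m dvd p ^ k \<and> t dvd m. \<alpha> (multiplicity p m)) = p ^ k * S j"
      using j by (simp add: tail flip: power_add mult.assoc)
    moreover have "(\<Sum>d | d dvd t. ramanujan_sum d (p ^ k div d) ^ u) = of_nat (S j)"
      unfolding j(1) sum_divisors_prime_power[OF p] S[OF j(2), symmetric]
      using p j(2) by (intro sum.cong refl) (auto simp: power_diff prime_gt_0_nat)
    ultimately show "of_nat (t * (\<Sum>m | m dvd p ^ k \<and> t dvd m. \<alpha> (multiplicity p m)))
        = of_nat (p ^ k) * (\<Sum>d | d dvd t. ramanujan_sum d (p ^ k div d) ^ u)"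
      by simp
  qed
qed

lemma ell_positive_prime_power_0:
  assumes "prime p"
  shows "ell_positive (p ^ k) 0"
proof (rule ell_positive_prime_power[OF assms, where S = Suc])
  fix b
  have "2 * Suc b \<le> p * Suc b" using prime_ge_2_nat[OF assms] by (rule mult_le_mono1)
  then show "Suc (Suc b) \<le> p * Suc b" by simp
qed simp

text \<open>
  These are the values that occur in \<open>R\<^sub>n\<^sub>,\<^sub>u\<close> for \<open>n = p\<^sup>k\<close>.  They vanish beyond the middle of the chain of
  divisors, apart from one negative value just after it when \<open>k\<close> is odd.
\<close>

lemma ramanujan_sum_prime_power_complement:
  assumes "prime p" "i < k"
  shows "ramanujan_sum (p ^ Suc i) (p ^ (k - Suc i)) =
    (if 2 * Suc i \<le> k then of_nat (p ^ Suc i) else 0) - (if 2 * i < k then of_nat (p ^ i) else 0)"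
proof -
  have "p ^ Suc i dvd p ^ (k - Suc i) \<longleftrightarrow> 2 * Suc i \<le> k" "p ^ i dvd p ^ (k - Suc i) \<longleftrightarrow> 2 * i < k"
    using assms prime_ge_2_nat[OF assms(1)] by (auto simp: dvd_power_iff_le simp del: power_Suc)
  then show ?thesis unfolding ramanujan_sum_prime_power_Suc[OF assms(1)] by simp
qed

text \<open>
  Up to the middle the terms of the partial sums are \<open>\<phi>(p\<^sup>i)\<close>, which add up to \<open>p\<^sup>b\<close>.  If \<open>k = 2b + 1\<close>, the next
  term is \<open>-p\<^sup>b\<close> and cancels this; all further terms are zero.
\<close>

lemma ell_positive_prime_power_1:
  assumes "prime p"
  shows "ell_positive (p ^ k) 1"
proof -
  define S where "S b = (if 2 * b \<le> k then p ^ b else if even k then p ^ (k div 2) else 0)" for b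
  have p1: "1 \<le> p" using prime_ge_1_nat[OF assms] .
  show ?thesis
  proof (rule ell_positive_prime_power[OF assms, where S = S])
    fix b assume "b \<le> k"
    then show "(\<Sum>i\<le>b. ramanujan_sum (p ^ i) (p ^ (k - i)) ^ 1) = of_nat (S b)"
    proof (induction b)
      case (Suc b)
      have step: "(\<Sum>i\<le>Suc b. ramanujan_sum (p ^ i) (p ^ (k - i)) ^ 1) = of_nat (S b) +
          ((if 2 * Suc b \<le> k then of_nat (p ^ Suc b) else 0) - (if 2 * b < k then of_nat (p ^ b) else 0))"
        using Suc.IH Suc.prems ramanujan_sum_prime_power_complement[OF assms, of b k]
        by (simp only: sum.atMost_Suc power_one_right Suc_le_eq less_imp_le)
      consider "2 * Suc b \<le> k" | "k = Suc (2 * b)" | "k = 2 * b" | "k < 2 * b"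
        by atomize_elim presburger
      then show ?case unfolding step by cases (simp_all add: S_def)
    qed (simp add: S_def ramanujan_sum_1_left)
  next
    fix b assume "b < k"
    consider "2 * Suc b \<le> k" | "k = Suc (2 * b)" | "k = 2 * b" | "k < 2 * b"
      by atomize_elim presburger
    then show "S (Suc b) \<le> p * S b" using p1 by cases (simp_all add: S_def)
  qed
qed

text \<open>
  The values to be raised to the power \<open>u\<close> are \<open>c\<^sub>1(p) = 1\<close> and \<open>c\<^sub>p(1) = -1\<close>, so that \<open>S\<^sub>0 = 1\<close> and
  \<open>S\<^sub>1 = 1 + (-1)\<^sup>u\<close>.
\<close>

lemma ell_positive_prime:
  assumes "prime p"
  shows "ell_positive p u"
proof -
  define S :: "nat \<Rightarrow> nat" where "S b = (if b = 0 then 1 else if even u then 2 else 0)" for b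
  have c: "ramanujan_sum p 1 = -1"
    using ramanujan_sum_prime_power_complement[OF assms, of 0 1] by simp
  have "ell_positive (p ^ 1) u"
  proof (rule ell_positive_prime_power[OF assms, where S = S])
    fix b :: nat assume "b \<le> 1"
    then consider "b = 0" | "b = Suc 0" by linarith
    then show "(\<Sum>i\<le>b. ramanujan_sum (p ^ i) (p ^ (1 - i)) ^ u) = of_nat (S b)"
      by cases (use c in \<open>auto simp: S_def ramanujan_sum_1_left\<close>)
  qed (use prime_ge_2_nat[OF assms] in \<open>auto simp: S_def\<close>)
  then show ?thesis by simp
qed

text \<open>
  The values to be raised to the power \<open>u\<close> are \<open>c\<^sub>1(4) = c\<^sub>2(2) = 1\<close> and \<open>c\<^sub>4(1) = 0\<close>; the last power
  is \<open>0\<close> except for \<open>u = 0\<close>.  The growth condition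
  \<open>S\<^sub>1 \<le> 2 S\<^sub>0\<close> is tight here.
\<close>

lemma ell_positive_4: "ell_positive 4 u"
proof (cases "u = 0")
  case True
  then show ?thesis using ell_positive_prime_power_0[of 2 2] by simp
next
  case False
  define S :: "nat \<Rightarrow> nat" where "S b = (if b = 0 then 1 else 2)" for b
  have c: "ramanujan_sum 2 2 = 1" "ramanujan_sum 4 1 = 0"
    using ramanujan_sum_prime_power_complement[of 2 0 2] ramanujan_sum_prime_power_complement[of 2 1 2] by simp_all
  have "ell_positive (2 ^ 2) u"
  proof (rule ell_positive_prime_power[where S = S])
    fix b :: nat assume "b \<le> 2"
    then consider "b = 0" | "b = Suc 0" | "b = Suc (Suc 0)" by linarith
    then show "(\<Sum>i\<le>b. ramanujan_sum (2 ^ i) (2 ^ (2 - i)) ^ u) = of_nat (S b)"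
      by cases (use c False in \<open>auto simp: S_def ramanujan_sum_1_left\<close>)
  qed (auto simp: S_def)
  then show ?thesis by simp
qed

text \<open>
  In each case every prime power exactly dividing \<open>n\<close> is covered: it is arbitrary with \<open>u \<le> 1\<close>, or prime, or
  equal to \<open>4\<close>.
\<close>

lemma ell_positive_cases:
  assumes n: "n > 0"
    and cases: "u \<in> {0, 1} \<or> squarefree n \<or> (\<exists>m. n = 4 * m \<and> odd m \<and> squarefree m)"
  shows "ell_positive n u"
proof (rule ell_positive_local[OF n])
  fix p assume p: "prime p" "p dvd n"
  have one: "multiplicity p m = 1" if "squarefree m" "p dvd m" for m
    using that p(1) by (metis squarefree_factorial_semiring'' prime_multiplicity_gt_zero_iff not_squarefree_0 One_nat_def Suc_leI le_antisym prime_imp_prime_elem neq0_conv)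
  from cases consider "u = 0" | "u = 1" | "squarefree n" | m where "n = 4 * m" "odd m" "squarefree m" by blast
  then show "ell_positive (p ^ multiplicity p n) u"
  proof cases
    case 3
    then show ?thesis using one p by (simp add: ell_positive_prime)
  next
    case (4 m)
    have m0: "m \<noteq> 0" using 4(3) not_squarefree_0 by metis
    have split: "multiplicity p n = multiplicity p 4 + multiplicity p m"
      using p m0 4(1) by (simp add: prime_elem_multiplicity_mult_distrib)
    show ?thesis
    proof (cases "p = 2")
      case True
      then have "multiplicity p n = 2"
        using split 4(2) multiplicity_prime_power[OF prime_imp_prime_elem[OF two_is_prime_nat], of 2]
        by (simp add: not_dvd_imp_multiplicity_0)
      then show ?thesis using True ell_positive_4 by simp
    next
      case False
      then have "multiplicity p 4 = 0"
        using p multiplicity_distinct_prime_power[of p 2 2] by simp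
      moreover have "p dvd m" using p False 4(1) prime_dvd_power[of p 2 2]
        by (auto simp: prime_dvd_mult_iff primes_dvd_imp_eq)
      ultimately have "multiplicity p n = 1" using split one 4(3) by simp
      then show ?thesis using p by (simp add: ell_positive_prime)
    qed
  qed (use p ell_positive_prime_power_0 ell_positive_prime_power_1 in auto)
qed


theorem theorem36:
  fixes n u :: nat
  assumes "n > 0"
    and "u \<in> {0, 1}
         \<or> squarefree n
         \<or> (\<exists>m. n = 4 * m \<and> odd m \<and> squarefree m)"
  shows "\<exists>a :: nat \<Rightarrow> nat. ramanujan_symfun n u = (\<Sum>m | m dvd n. of_nat (a m) * ell n m)"
proof -
  obtain a :: "nat \<Rightarrow> nat" where "\<And>d. d dvd n \<Longrightarrow>
     (\<Sum>m | m dvd n. of_nat (a m) * ramanujan_sum d m) = of_nat n * ramanujan_sum d (n div d) ^ u"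
    using ell_positive_imp_weights[OF assms(1) ell_positive_cases[OF assms]] by blast
  then show ?thesis
    using ramanujan_symfun_conv_ell[OF assms(1)] by blast
qed

end
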